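(* The ideal $\mathcal R$ on $\omega$ generated by the homogeneous sets in some fixed instance of the random graph on $\omega$ is not $\le_K$-homogeneous (in particular, it is not homogeneous).
   Context: An ideal on a set $X$ is a family of subsets of $X$ closed under finite unions and subsets, containing all finite subsets of $X$ and not containing $X$; $\mathcal I^+=\mathcal P(X)\setminus\mathcal I$. The random graph on $\omega$ is the (unique up to isomorphism) countable graph with vertex set $\omega$ such that for any two disjoint finite sets $U,V\subseteq\omega$ there is a vertex outside $U\cup V$ adjacent to all vertices of $U$ and to none of $V$. A set of vertices is homogeneous (in the graph) if it is a clique or an independent set. $\mathcal R$ consists of all subsets of finite unions of homogeneous sets. For ideals $\mathcal I$ on $X$ and $\mathcal K$ on $Y$, $\mathcal I\le_K\mathcal K$ (Katětov order) means that there is $f:Y\to X$ with $f^{-1}[B]\in\mathcal K$ for all $B\in\mathcal I$; $\mathcal I$ and $\mathcal K$ are isomorphic if there is a bijection $f:Y\to X$ with $f^{-1}[B]\in\mathcal K\iff B\in\mathcal I$. For $A\in\mathcal I^+$, $\mathcal I\restriction A=\{B\cap A:B\in\mathcal I\}$ (an ideal on $A$). An ideal $\mathcal I$ is homogeneous if $\mathcal I\restriction A$ is isomorphic to $\mathcal I$ for each $A\in\mathcal I^+$, and $\le_K$-homogeneous if $\mathcal I\restriction A\le_K\mathcal I$ and $\mathcal I\le_K\mathcal I\restriction A$ for each $A\in\mathcal I^+$. *)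

theory Defs
  imports Main
begin

section \<open>Ideals on a set\<close>

definition ideal_on :: "'a set \<Rightarrow> 'a set set \<Rightarrow> bool" where
  "ideal_on X I \<longleftrightarrow>
     I \<subseteq> Pow X \<and>
     (\<forall>A\<in>I. \<forall>B\<in>I. A \<union> B \<in> I) \<and>
     (\<forall>A\<in>I. \<forall>B. B \<subseteq> A \<longrightarrow> B \<in> I) \<and>
     (\<forall>A. A \<subseteq> X \<and> finite A \<longrightarrow> A \<in> I) \<and>
     X \<notin> I"

definition positive_sets :: "'a set \<Rightarrow> 'a set set \<Rightarrow> 'a set set" where
  "positive_sets X I = Pow X - I"

text \<open>The restriction is meant as a family of subsets of \<open>A\<close>; the new underlying set \<open>A\<close>
  is passed separately wherever it matters.\<close>

definition restrict_ideal :: "'a set set \<Rightarrow> 'a set \<Rightarrow> 'a set set" where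
  "restrict_ideal I A = {B \<inter> A | B. B \<in> I}"

text \<open>In the next two definitions \<open>I\<close> lives on \<open>X\<close> and \<open>K\<close> lives on \<open>Y\<close>. Since HOL functions
  are total on the type, the preimage of \<open>B\<close> under a map \<open>Y \<rightarrow> X\<close> is \<open>f -` B \<inter> Y\<close>.\<close>

definition katetov_le :: "'a set \<Rightarrow> 'a set set \<Rightarrow> 'b set \<Rightarrow> 'b set set \<Rightarrow> bool" where
  "katetov_le X I Y K \<longleftrightarrow>
     (\<exists>f. f ` Y \<subseteq> X \<and> (\<forall>B\<in>I. f -` B \<inter> Y \<in> K))"

definition ideal_isomorphic :: "'a set \<Rightarrow> 'a set set \<Rightarrow> 'b set \<Rightarrow> 'b set set \<Rightarrow> bool" where
  "ideal_isomorphic X I Y K \<longleftrightarrow>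
     (\<exists>f. bij_betw f Y X \<and> (\<forall>B. B \<subseteq> X \<longrightarrow> (f -` B \<inter> Y \<in> K \<longleftrightarrow> B \<in> I)))"

definition homogeneous_ideal :: "'a set \<Rightarrow> 'a set set \<Rightarrow> bool" where
  "homogeneous_ideal X I \<longleftrightarrow>
     (\<forall>A\<in>positive_sets X I. ideal_isomorphic A (restrict_ideal I A) X I)"

definition katetov_homogeneous_ideal :: "'a set \<Rightarrow> 'a set set \<Rightarrow> bool" where
  "katetov_homogeneous_ideal X I \<longleftrightarrow>
     (\<forall>A\<in>positive_sets X I.
        katetov_le A (restrict_ideal I A) X I \<and> katetov_le X I A (restrict_ideal I A))"


section \<open>The random graph and the ideal generated by its homogeneous sets\<close>

text \<open>A graph on the whole type is given by its adjacency relation.\<close>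

definition random_graph :: "(nat \<Rightarrow> nat \<Rightarrow> bool) \<Rightarrow> bool" where
  "random_graph E \<longleftrightarrow>
     irreflp E \<and> symp E \<and>
     (\<forall>U V. finite U \<and> finite V \<and> U \<inter> V = {} \<longrightarrow>
        (\<exists>z. z \<notin> U \<union> V \<and> (\<forall>u\<in>U. E z u) \<and> (\<forall>v\<in>V. \<not> E z v)))"

definition clique :: "('a \<Rightarrow> 'a \<Rightarrow> bool) \<Rightarrow> 'a set \<Rightarrow> bool" where
  "clique E H \<longleftrightarrow> (\<forall>x\<in>H. \<forall>y\<in>H. x \<noteq> y \<longrightarrow> E x y)"

definition independent_set :: "('a \<Rightarrow> 'a \<Rightarrow> bool) \<Rightarrow> 'a set \<Rightarrow> bool" where
  "independent_set E H \<longleftrightarrow> (\<forall>x\<in>H. \<forall>y\<in>H. \<not> E x y)"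

definition homogeneous_set :: "('a \<Rightarrow> 'a \<Rightarrow> bool) \<Rightarrow> 'a set \<Rightarrow> bool" where
  "homogeneous_set E H \<longleftrightarrow> clique E H \<or> independent_set E H"

definition homogeneous_sets_ideal :: "('a \<Rightarrow> 'a \<Rightarrow> bool) \<Rightarrow> 'a set set" where
  "homogeneous_sets_ideal E =
     {A. \<exists>\<H>. finite \<H> \<and> (\<forall>H\<in>\<H>. homogeneous_set E H) \<and> A \<subseteq> \<Union>\<H>}"

end

theory Submission
  imports Defs "HOL-Library.Nat_Bijection"
begin

text \<open>
  Write \<open>R\<close> for the ideal generated by the homogeneous sets of the random graph. Two facts about
  the random graph carry the proof.

  First, for disjoint finite \<open>U\<close> and \<open>V\<close> the set of all vertices joined to everything in \<open>U\<close> and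
  to nothing in \<open>V\<close> is not in \<open>R\<close> (\<open>extension_set_not_in_ideal\<close>): if finitely many homogeneous
  sets covered it and one of them, say a clique, contained a vertex \<open>x\<close> of it, then adding \<open>x\<close>
  to \<open>V\<close> would give a set of the same kind covered by one homogeneous set fewer.

  Second, whenever the vertices are partitioned into pieces belonging to \<open>R\<close>, every countable graph
  is isomorphic to an induced subgraph that meets each piece in at most one vertex
  (\<open>transversal_embedding\<close>). The vertices are chosen greedily; at each step the candidates
  with the correct adjacencies form a set not in \<open>R\<close>, hence are not exhausted by the finitely many
  pieces already used.

  Let \<open>A\<close> be the vertex set of an induced copy of a disjoint union of infinitely many infinite
  cliques, the columns. No finite family of homogeneous sets covers \<open>A\<close>, so \<open>A\<close> is positive.
  If \<open>f\<close> maps the vertices to \<open>A\<close> and witnesses \<open>R \<restriction> A \<le> R\<close> in the Katetov order,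
  then the \<open>f\<close>-preimages of the columns partition the vertices into pieces in \<open>R\<close>. Choose a
  transversal copy \<open>S\<close> of the random graph itself; then \<open>S\<close> is not in \<open>R\<close>. But \<open>f ` S\<close> meets every
  column in at most one point, so it is independent, and its preimage, which contains \<open>S\<close>, would
  have to be in \<open>R\<close>. This refutes Katetov homogeneity, and an isomorphism of \<open>R\<close> with
  \<open>R \<restriction> A\<close> is in particular a Katetov reduction.
\<close>

section \<open>The ideal generated by the homogeneous sets of a graph\<close>

lemma homogeneous_sets_ideal_mono:
  assumes "A \<in> homogeneous_sets_ideal E" "B \<subseteq> A"
  shows "B \<in> homogeneous_sets_ideal E"
proof -
  obtain \<H> where "finite \<H>" "\<forall>H\<in>\<H>. homogeneous_set E H" "A \<subseteq> \<Union>\<H>"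
    using assms(1) unfolding homogeneous_sets_ideal_def by blast
  moreover from this(3) have "B \<subseteq> \<Union>\<H>"
    using assms(2) by (rule order_trans[rotated])
  ultimately show ?thesis
    unfolding homogeneous_sets_ideal_def by blast
qed

lemma homogeneous_sets_ideal_homogeneous:
  assumes "homogeneous_set E H"
  shows "H \<in> homogeneous_sets_ideal E"
  unfolding homogeneous_sets_ideal_def using assms by (auto intro!: exI[of _ "{H}"])

lemma homogeneous_sets_ideal_UN:
  assumes "finite F" "\<And>i. i \<in> F \<Longrightarrow> A i \<in> homogeneous_sets_ideal E"
  shows "(\<Union>i\<in>F. A i) \<in> homogeneous_sets_ideal E"
proof -
  have "\<forall>i\<in>F. \<exists>\<H>. finite \<H> \<and> (\<forall>H\<in>\<H>. homogeneous_set E H) \<and> A i \<subseteq> \<Union>\<H>"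
    using assms(2) unfolding homogeneous_sets_ideal_def by blast
  then obtain \<H> where \<H>: "\<forall>i\<in>F. finite (\<H> i) \<and> (\<forall>H\<in>\<H> i. homogeneous_set E H) \<and> A i \<subseteq> \<Union>(\<H> i)"
    by metis
  then have "finite (\<Union>i\<in>F. \<H> i)" "\<forall>H\<in>(\<Union>i\<in>F. \<H> i). homogeneous_set E H"
    "(\<Union>i\<in>F. A i) \<subseteq> \<Union>(\<Union>i\<in>F. \<H> i)"
    using assms(1) by auto blast
  then show ?thesis
    unfolding homogeneous_sets_ideal_def by blast
qed

lemma homogeneous_sets_ideal_finite:
  assumes "finite A"
  shows "A \<in> homogeneous_sets_ideal E"
proof -
  have "(\<Union>x\<in>A. {x}) \<in> homogeneous_sets_ideal E"
    using assms
    by (intro homogeneous_sets_ideal_UN homogeneous_sets_ideal_homogeneous)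
      (auto simp: homogeneous_set_def clique_def)
  then show ?thesis by simp
qed

lemma homogeneous_sets_ideal_Un:
  assumes "A \<in> homogeneous_sets_ideal E" "B \<in> homogeneous_sets_ideal E"
  shows "A \<union> B \<in> homogeneous_sets_ideal E"
  using homogeneous_sets_ideal_UN[of "{A, B}" "\<lambda>X. X" E] assms by auto

lemma homogeneous_sets_ideal_vimage_embedding:
  assumes "A \<in> homogeneous_sets_ideal E"
    and emb: "\<And>i j. i \<noteq> j \<Longrightarrow> v i \<noteq> v j \<and> E (v i) (v j) = G i j"
    and irr: "irreflp G"
  shows "v -` A \<in> homogeneous_sets_ideal G"
proof -
  obtain \<H> where \<H>: "finite \<H>" "\<forall>H\<in>\<H>. homogeneous_set E H" "A \<subseteq> \<Union>\<H>"
    using assms(1) unfolding homogeneous_sets_ideal_def by blast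
  have "homogeneous_set G (v -` H)" if "homogeneous_set E H" for H
  proof (cases "clique E H")
    case True
    then have "clique G (v -` H)"
      using emb unfolding clique_def by (metis vimage_eq)
    then show ?thesis
      unfolding homogeneous_set_def ..
  next
    case False
    then have "independent_set E H"
      using that unfolding homogeneous_set_def by blast
    then have "independent_set G (v -` H)"
      using emb irreflpD[OF irr] unfolding independent_set_def by (metis vimage_eq)
    then show ?thesis
      unfolding homogeneous_set_def ..
  qed
  then have "\<forall>H\<in>(\<lambda>H. v -` H) ` \<H>. homogeneous_set G H"
    using \<H>(2) by blast
  moreover have "v -` A \<subseteq> \<Union>((\<lambda>H. v -` H) ` \<H>)"
    using \<H>(3) by blast
  ultimately show ?thesis
    unfolding homogeneous_sets_ideal_def using \<H>(1) by blast
qed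

section \<open>Extension sets and transversal embeddings\<close>

lemma extension_set_not_in_ideal:
  assumes "random_graph E" "finite U" "finite V" "U \<inter> V = {}"
  shows "{z. z \<notin> U \<union> V \<and> (\<forall>u\<in>U. E z u) \<and> (\<forall>v\<in>V. \<not> E z v)} \<notin> homogeneous_sets_ideal E"
proof -
  define W where "W U V = {z. z \<notin> U \<union> V \<and> (\<forall>u\<in>U. E z u) \<and> (\<forall>v\<in>V. \<not> E z v)}" for U V
  have W_Un: "x \<notin> U \<union> V" if "x \<in> W U V" for x U V
    using that by (simp add: W_def)
  have W_adj: "E z x" "z \<noteq> x" if "z \<in> W (insert x U) V" for z x U V
    using that by (auto simp: W_def)
  have W_nonadj: "\<not> E z x" "z \<noteq> x" if "z \<in> W U (insert x V)" for z x U V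
    using that by (auto simp: W_def)
  have W_subset: "W (insert x U) V \<subseteq> W U V" "W U (insert x V) \<subseteq> W U V" for x U V
    by (auto simp: W_def)
  have "\<not> W U V \<subseteq> \<Union>\<H>" if "finite \<H>" "\<forall>H\<in>\<H>. homogeneous_set E H" for \<H>
    using that assms(2-4)
  proof (induction \<H> arbitrary: U V rule: finite_induct)
    case empty
    have "\<exists>z. z \<in> W U V"
      using assms(1) empty.prems(2-4) unfolding random_graph_def W_def mem_Collect_eq by metis
    then show ?case
      by blast
  next
    case (insert H \<H>)
    have hom: "\<forall>H\<in>\<H>. homogeneous_set E H"
      using insert.prems(1) by blast
    show ?case
    proof
      assume cover: "W U V \<subseteq> \<Union>(insert H \<H>)"
      then have "W U V \<inter> H \<noteq> {}"
        using insert.IH[OF hom insert.prems(2-4)] by blast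
      then obtain x where x: "x \<in> W U V" "x \<in> H" by blast
      have "clique E H \<or> independent_set E H"
        using insert.prems(1) unfolding homogeneous_set_def by blast
      then show False
      proof
        assume "clique E H"
        then have "W U (insert x V) \<inter> H = {}"
          using x(2) W_nonadj unfolding clique_def by blast
        then have "W U (insert x V) \<subseteq> \<Union>\<H>"
          using cover W_subset(2)[of U x V] by blast
        moreover have "U \<inter> insert x V = {}"
          using W_Un[OF x(1)] insert.prems(4) by blast
        ultimately show False
          using insert.IH[OF hom insert.prems(2), of "insert x V"] insert.prems(3) by simp
      next
        assume "independent_set E H"
        then have "W (insert x U) V \<inter> H = {}"
          using x(2) W_adj unfolding independent_set_def by blast
        then have "W (insert x U) V \<subseteq> \<Union>\<H>"
          using cover W_subset(1)[of x U V] by blast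
        moreover have "insert x U \<inter> V = {}"
          using W_Un[OF x(1)] insert.prems(4) by blast
        ultimately show False
          using insert.IH[OF hom, of "insert x U" V] insert.prems(2,3) by simp
      qed
    qed
  qed
  then show ?thesis
    unfolding homogeneous_sets_ideal_def W_def by blast
qed

lemma random_graph_UNIV_not_in_ideal:
  assumes "random_graph E"
  shows "UNIV \<notin> homogeneous_sets_ideal E"
  using extension_set_not_in_ideal[OF assms, of "{}" "{}"] by simp

text \<open>The partition of the vertices is given by the fibres of \<open>p\<close>, and \<open>G\<close> is an arbitrary graph on
  the natural numbers; the values of \<open>G\<close> on the diagonal play no role.\<close>

lemma transversal_embedding:
  fixes G :: "nat \<Rightarrow> nat \<Rightarrow> bool"
  assumes rg: "random_graph E"
    and fibre: "\<And>c. p -` {c} \<in> homogeneous_sets_ideal E"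
    and symG: "symp G"
  obtains v where "\<And>i j. i \<noteq> j \<Longrightarrow> p (v i) \<noteq> p (v j) \<and> E (v i) (v j) = G i j"
proof -
  let ?P = "\<lambda>f n r. \<forall>i<n. p r \<noteq> p (f i) \<and> E r (f i) = G n i"
  have "\<exists>v. \<forall>n. ?P v n (v n)"
  proof (rule dependent_wellorder_choice)
    show "?P f n r = ?P g n r" if "\<And>i. i < n \<Longrightarrow> f i = g i" for r f g n
      using that by auto
  next
    fix n :: nat and f
    assume prev: "?P f k (f k)" if "k < n" for k
    define U where "U = f ` {i. i < n \<and> G n i}"
    define V where "V = f ` {i. i < n \<and> \<not> G n i}"
    have inj: "p (f i) \<noteq> p (f j)" if "i < n" "j < n" "i \<noteq> j" for i j
      using prev that by (metis linorder_neqE_nat)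
    have "U \<inter> V = {}"
      using inj unfolding U_def V_def by fastforce
    then have "{z. z \<notin> U \<union> V \<and> (\<forall>u\<in>U. E z u) \<and> (\<forall>v\<in>V. \<not> E z v)}
        \<notin> homogeneous_sets_ideal E" (is "?W \<notin> _")
      by (intro extension_set_not_in_ideal[OF rg]) (simp_all add: U_def V_def)
    moreover have "(\<Union>i\<in>{..<n}. p -` {p (f i)}) \<in> homogeneous_sets_ideal E"
      by (intro homogeneous_sets_ideal_UN fibre) simp
    ultimately obtain z where z: "z \<in> ?W" "z \<notin> (\<Union>i\<in>{..<n}. p -` {p (f i)})"
      using homogeneous_sets_ideal_mono by blast
    then have "?P f n z"
      unfolding U_def V_def by auto
    then show "\<exists>r. ?P f n r" ..
  qed
  then obtain v where v: "\<And>n. ?P v n (v n)" by blast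
  have "p (v i) \<noteq> p (v j) \<and> E (v i) (v j) = G i j" if "i \<noteq> j" for i j
  proof (cases "i < j")
    case True
    moreover have "symp E"
      using rg unfolding random_graph_def by blast
    ultimately show ?thesis
      using v[of j] symG by (metis sympD)
  next
    case False
    then show ?thesis
      using v[of i] that by auto
  qed
  then show thesis by (rule that)
qed

section \<open>Infinitely many infinite cliques\<close>

text \<open>Here \<open>u c n\<close> is the \<open>n\<close>-th vertex of column \<open>c\<close>. The pigeonhole principle is applied twice:
  in a finite cover, some member contains two points of a given infinite column, and the same
  member serves two different columns.\<close>

lemma columns_not_in_ideal:
  fixes u :: "nat \<Rightarrow> nat \<Rightarrow> 'a"
  assumes inj: "\<And>c n d m. u c n = u d m \<Longrightarrow> c = d \<and> n = m"
    and adj: "\<And>c n d m. (c, n) \<noteq> (d, m) \<Longrightarrow> E (u c n) (u d m) \<longleftrightarrow> c = d"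
  shows "(\<Union>c. range (u c)) \<notin> homogeneous_sets_ideal E"
proof
  assume "(\<Union>c. range (u c)) \<in> homogeneous_sets_ideal E"
  then obtain \<H> where \<H>: "finite \<H>" "\<forall>H\<in>\<H>. homogeneous_set E H"
    "(\<Union>c. range (u c)) \<subseteq> \<Union>\<H>"
    unfolding homogeneous_sets_ideal_def by blast
  have "\<exists>H\<in>\<H>. \<exists>n m. n \<noteq> m \<and> u c n \<in> H \<and> u c m \<in> H" for c
  proof -
    have "\<exists>h. \<forall>n. h n \<in> \<H> \<and> u c n \<in> h n"
      using \<H>(3) by (intro choice) blast
    then obtain h where h: "\<And>n. h n \<in> \<H> \<and> u c n \<in> h n" by blast
    then have "\<not> inj h"
      using \<H>(1) by (metis finite_subset image_subsetI infinite_UNIV_nat finite_imageD)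
    then show ?thesis
      using h unfolding inj_def by metis
  qed
  then have "\<exists>h. \<forall>c. h c \<in> \<H> \<and> (\<exists>n m. n \<noteq> m \<and> u c n \<in> h c \<and> u c m \<in> h c)"
    by (intro choice) blast
  then obtain h where h: "\<And>c. h c \<in> \<H> \<and> (\<exists>n m. n \<noteq> m \<and> u c n \<in> h c \<and> u c m \<in> h c)" by blast
  then have "\<not> inj h"
    using \<H>(1) by (metis finite_subset image_subsetI infinite_UNIV_nat finite_imageD)
  then obtain c d where cd: "c \<noteq> d" "h c = h d"
    unfolding inj_def by blast
  \<comment> \<open>One homogeneous set contains two points of column \<open>c\<close>, so it is not independent, and
    points of two different columns, so it is not a clique.\<close>
  obtain n m where nm: "n \<noteq> m" "u c n \<in> h c" "u c m \<in> h c"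
    using h by blast
  obtain k where k: "u d k \<in> h c"
    using h[of d] cd by auto
  have "E (u c n) (u c m)" "\<not> E (u c n) (u d k)" "u c n \<noteq> u d k"
    using adj[of c n c m] adj[of c n d k] inj[of c n d k] nm(1) cd(1) by auto
  then have "\<not> homogeneous_set E (h c)"
    using nm k unfolding homogeneous_set_def clique_def independent_set_def by blast
  then show False
    using \<H>(2) h by blast
qed

lemma not_katetov_le_columns:
  fixes u :: "nat \<Rightarrow> nat \<Rightarrow> nat"
  assumes rg: "random_graph E"
    and inj: "\<And>c n d m. u c n = u d m \<Longrightarrow> c = d \<and> n = m"
    and adj: "\<And>c n d m. (c, n) \<noteq> (d, m) \<Longrightarrow> E (u c n) (u d m) \<longleftrightarrow> c = d"
    and A: "A = (\<Union>c. range (u c))"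
  shows "\<not> katetov_le A (restrict_ideal (homogeneous_sets_ideal E) A)
           UNIV (homogeneous_sets_ideal E)"
proof
  assume "katetov_le A (restrict_ideal (homogeneous_sets_ideal E) A)
    UNIV (homogeneous_sets_ideal E)"
  then obtain f where fA: "\<And>x. f x \<in> A"
    and f: "\<And>B. B \<in> restrict_ideal (homogeneous_sets_ideal E) A
        \<Longrightarrow> f -` B \<in> homogeneous_sets_ideal E"
    unfolding katetov_le_def by auto
  have f_hom: "f -` B \<in> homogeneous_sets_ideal E" if "homogeneous_set E B" "B \<subseteq> A" for B
  proof (rule f)
    have "B = B \<inter> A"
      using that(2) by blast
    then show "B \<in> restrict_ideal (homogeneous_sets_ideal E) A"
      unfolding restrict_ideal_def using homogeneous_sets_ideal_homogeneous[OF that(1)] by blast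
  qed
  have "\<exists>p. \<forall>x. \<exists>n. f x = u (p x) n"
    using fA unfolding A by (intro choice) blast
  then obtain p where p: "\<And>x. \<exists>n. f x = u (p x) n" by blast
  have fibre: "p -` {c} \<in> homogeneous_sets_ideal E" for c
  proof (rule homogeneous_sets_ideal_mono)
    have "clique E (range (u c))"
      unfolding clique_def using adj by (metis (no_types, lifting) prod.inject imageE)
    then show "f -` range (u c) \<in> homogeneous_sets_ideal E"
      using A by (intro f_hom) (auto simp: homogeneous_set_def)
    show "p -` {c} \<subseteq> f -` range (u c)"
      using p by auto (metis rangeI)
  qed
  have irrE: "irreflp E" and symE: "symp E"
    using rg unfolding random_graph_def by auto
  obtain v where v: "\<And>i j. i \<noteq> j \<Longrightarrow> p (v i) \<noteq> p (v j) \<and> E (v i) (v j) = E i j"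
    using transversal_embedding[OF rg fibre symE] by blast
  define S where "S = range v"
  have "independent_set E (f ` S)"
    unfolding independent_set_def
  proof (intro ballI)
    fix x y assume "x \<in> f ` S" "y \<in> f ` S"
    then obtain i j where ij: "x = f (v i)" "y = f (v j)"
      unfolding S_def by blast
    obtain n m where nm: "x = u (p (v i)) n" "y = u (p (v j)) m"
      using p ij by metis
    show "\<not> E x y"
    proof (cases "i = j")
      case True
      then show ?thesis
        using ij irrE by (simp add: irreflpD)
    next
      case False
      then show ?thesis
        using nm adj v[of i j] by blast
    qed
  qed
  then have "f -` (f ` S) \<in> homogeneous_sets_ideal E"
    using fA by (intro f_hom) (auto simp: homogeneous_set_def)
  then have "S \<in> homogeneous_sets_ideal E"
    by (rule homogeneous_sets_ideal_mono) blast
  then have "v -` S \<in> homogeneous_sets_ideal E"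
    by (rule homogeneous_sets_ideal_vimage_embedding) (use v irrE in metis)+
  moreover have "v -` S = UNIV"
    unfolding S_def by blast
  ultimately show False
    using random_graph_UNIV_not_in_ideal[OF rg] by simp
qed

lemma ex_positive_not_katetov_le:
  assumes rg: "random_graph E"
  shows "\<exists>A\<in>positive_sets UNIV (homogeneous_sets_ideal E).
    \<not> katetov_le A (restrict_ideal (homogeneous_sets_ideal E) A)
       UNIV (homogeneous_sets_ideal E)"
proof -
  define G where "G i j \<longleftrightarrow> fst (prod_decode i) = fst (prod_decode j)" for i j
  have "symp G"
    unfolding G_def by (simp add: symp_def)
  moreover have "id -` {c} \<in> homogeneous_sets_ideal E" for c
    by (rule homogeneous_sets_ideal_finite) simp
  ultimately obtain v where
    v: "\<And>i j. i \<noteq> j \<Longrightarrow> id (v i) \<noteq> id (v j) \<and> E (v i) (v j) = G i j"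
    using transversal_embedding[OF rg, of id G] by blast
  define u where "u c n = v (prod_encode (c, n))" for c n
  have inj: "c = d \<and> n = m" if "u c n = u d m" for c n d m
    using that v[of "prod_encode (c, n)" "prod_encode (d, m)"] unfolding u_def by auto
  have adj: "E (u c n) (u d m) \<longleftrightarrow> c = d" if "(c, n) \<noteq> (d, m)" for c n d m
    using that v[of "prod_encode (c, n)" "prod_encode (d, m)"] unfolding u_def G_def by auto
  show ?thesis
  proof (rule bexI)
    show "\<not> katetov_le (\<Union>c. range (u c))
        (restrict_ideal (homogeneous_sets_ideal E) (\<Union>c. range (u c)))
        UNIV (homogeneous_sets_ideal E)"
      by (rule not_katetov_le_columns[OF rg inj adj refl])
    show "(\<Union>c. range (u c)) \<in> positive_sets UNIV (homogeneous_sets_ideal E)"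
      unfolding positive_sets_def using columns_not_in_ideal[of u E, OF inj adj] by blast
  qed
qed

section \<open>Failure of homogeneity\<close>

lemma ideal_isomorphic_imp_katetov_le:
  assumes "ideal_isomorphic X I Y K" "I \<subseteq> Pow X"
  shows "katetov_le X I Y K"
proof -
  obtain f where f: "bij_betw f Y X" "\<forall>B. B \<subseteq> X \<longrightarrow> (f -` B \<inter> Y \<in> K \<longleftrightarrow> B \<in> I)"
    using assms(1) unfolding ideal_isomorphic_def by blast
  then have "f ` Y \<subseteq> X" "\<forall>B\<in>I. f -` B \<inter> Y \<in> K"
    using assms(2) by (auto simp: bij_betw_def)
  then show ?thesis
    unfolding katetov_le_def by blast
qed

theorem proposition10p4:
  fixes E :: "nat \<Rightarrow> nat \<Rightarrow> bool"
  assumes "random_graph E"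
  shows "ideal_on UNIV (homogeneous_sets_ideal E) \<and>
         \<not> katetov_homogeneous_ideal UNIV (homogeneous_sets_ideal E) \<and>
         \<not> homogeneous_ideal UNIV (homogeneous_sets_ideal E)"
proof (intro conjI)
  show "ideal_on UNIV (homogeneous_sets_ideal E)"
    unfolding ideal_on_def
    by (auto intro: homogeneous_sets_ideal_Un homogeneous_sets_ideal_finite
        elim: homogeneous_sets_ideal_mono simp: random_graph_UNIV_not_in_ideal[OF assms])
  obtain A where A: "A \<in> positive_sets UNIV (homogeneous_sets_ideal E)"
    "\<not> katetov_le A (restrict_ideal (homogeneous_sets_ideal E) A)
       UNIV (homogeneous_sets_ideal E)"
    using ex_positive_not_katetov_le[OF assms] by blast
  then show "\<not> katetov_homogeneous_ideal UNIV (homogeneous_sets_ideal E)"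
    unfolding katetov_homogeneous_ideal_def by blast
  have "restrict_ideal (homogeneous_sets_ideal E) A \<subseteq> Pow A"
    unfolding restrict_ideal_def by blast
  then have "\<not> ideal_isomorphic A (restrict_ideal (homogeneous_sets_ideal E) A)
      UNIV (homogeneous_sets_ideal E)"
    using A(2) ideal_isomorphic_imp_katetov_le by blast
  then show "\<not> homogeneous_ideal UNIV (homogeneous_sets_ideal E)"
    using A(1) unfolding homogeneous_ideal_def by blast
qed

end
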